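(* Let $Z\subseteq\mathbb{R}^d$ be closed and convex, let $F,G:Z\to\mathbb{R}$ be $\mu$-strongly convex on $Z$ ($\mu>0$), and let $z^*$ be the unique optimal solution of $\min_{z\in Z}F(z)$ s.t. $G(z)\le0$. Let $\tau>0$ and suppose there are constants $L_0,L_1\ge0$ such that for all $z_1\in\{z\in Z: G(z)\le\tau\}$ and all $z_2\in\{z\in Z:G(z)>\tau\}$ the subgradients $\zeta_F\in\partial F(z_1)$ and $\zeta_G\in\partial G(z_2)$ (available to the algorithm) satisfy $$\|\zeta_F\|^2\le L_0^2+L_1(F(z_1)-F(z^* )),\qquad \|\zeta_G\|^2\le L_0^2+L_1(G(z_2)-G(z^* )).$$ Let $\alpha_t=\frac{2}{\mu(t+2)+\frac{L_1^2}{\mu(t+1)}}$ and let $z_0\in Z$ with $G(z_0)\le\tau$. Then the output $\bar z_T$ of the switching subgradient method $SSM(\tau,T,z_0,\{\alpha_t\})$ is a $(\tau,\tau)$-optimal solution, i.e. $F(\bar z_T)-F(z^* )\le\tau$ and $G(\bar z_T)\le\tau$, for all integers $T\geq 1$ with $$T\ge\max\left\{\frac{8L_0^2}{\mu\tau},\sqrt{\frac{2L_1^2\|z_0-z^*\|^2}{\mu\tau}}\right\}.$$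
   Context: Norms are Euclidean. A function $h$ is $\mu$-strongly convex on $Z$ if $h-\frac{\mu}{2}\|\cdot\|^2$ is convex on $Z$; equivalently $h(z')\ge h(z)+\zeta^T(z'-z)+\frac{\mu}{2}\|z'-z\|^2$ for all $z,z'\in Z$, $\zeta\in\partial h(z)$, where $\partial h(z)=\{\zeta: h(z')\ge h(z)+\zeta^T(z'-z)\ \forall z'\in Z\}$. Switching subgradient method $SSM(\tau,T,z_0,\{\alpha_t\})$ for $\min_{z\in Z}F(z)$ s.t. $G(z)\le0$: start with $I=J=\emptyset$. For $t=0,\dots,T-1$: if $G(z_t)\le\tau$, set $z_{t+1}=\mathrm{proj}_Z(z_t-\alpha_t\zeta_{Ft})$ with $\zeta_{Ft}\in\partial F(z_t)$ and add $t$ to $I$; otherwise set $z_{t+1}=\mathrm{proj}_Z(z_t-\alpha_t\zeta_{Gt})$ with $\zeta_{Gt}\in\partial G(z_t)$ and add $t$ to $J$. Output $\bar z_T=\frac{\sum_{t\in I}(t+1)z_t}{\sum_{t\in I}(t+1)}$. Here $\mathrm{proj}_Z$ is orthogonal projection onto $Z$. The subgradients used in the algorithm are those for which the displayed norm bounds hold. *)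

theory Defs
  imports "HOL-Analysis.Analysis"
begin

text \<open>
  Functions on \<open>Z\<close> are represented by total functions; every notion below depends only on
  their values on \<open>Z\<close>. Accordingly subgradients are taken relative to \<open>Z\<close>.
\<close>

definition strongly_convex_on :: "real \<Rightarrow> 'a::real_inner set \<Rightarrow> ('a \<Rightarrow> real) \<Rightarrow> bool" where
  "strongly_convex_on \<mu> Z h \<longleftrightarrow> convex_on Z (\<lambda>z. h z - \<mu> / 2 * (norm z)\<^sup>2)"

definition subdifferential :: "'a::real_inner set \<Rightarrow> ('a \<Rightarrow> real) \<Rightarrow> 'a \<Rightarrow> 'a set" where
  "subdifferential Z h z = {\<zeta>. \<forall>z'\<in>Z. h z' \<ge> h z + \<zeta> \<bullet> (z' - z)}"

definition optimal_solution :: "'a set \<Rightarrow> ('a \<Rightarrow> real) \<Rightarrow> ('a \<Rightarrow> real) \<Rightarrow> 'a \<Rightarrow> bool" where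
  "optimal_solution Z F G z \<longleftrightarrow>
     z \<in> Z \<and> G z \<le> 0 \<and> (\<forall>z'\<in>Z. G z' \<le> 0 \<longrightarrow> F z \<le> F z')"

definition approx_optimal_solution ::
    "'a set \<Rightarrow> ('a \<Rightarrow> real) \<Rightarrow> ('a \<Rightarrow> real) \<Rightarrow> 'a \<Rightarrow> real \<Rightarrow> real \<Rightarrow> 'a \<Rightarrow> bool" where
  "approx_optimal_solution Z F G zs \<epsilon> \<delta> z \<longleftrightarrow> z \<in> Z \<and> F z - F zs \<le> \<epsilon> \<and> G z \<le> \<delta>"

text \<open>
  A run of the switching subgradient method: \<open>z\<close> is a possible sequence of iterates
  \<open>z 0, ..., z T\<close> (later values are irrelevant). \<open>SF w\<close> and \<open>SG w\<close> are the subgradients of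
  \<open>F\<close> and \<open>G\<close> at \<open>w\<close> that are available to the algorithm; each step uses an arbitrary one of them.
\<close>

definition ssm_run ::
    "'a::euclidean_space set \<Rightarrow> ('a \<Rightarrow> real) \<Rightarrow> ('a \<Rightarrow> real) \<Rightarrow> ('a \<Rightarrow> 'a set) \<Rightarrow> ('a \<Rightarrow> 'a set) \<Rightarrow>
     real \<Rightarrow> nat \<Rightarrow> 'a \<Rightarrow> (nat \<Rightarrow> real) \<Rightarrow> (nat \<Rightarrow> 'a) \<Rightarrow> bool" where
  "ssm_run Z F G SF SG \<tau> T z0 \<alpha> z \<longleftrightarrow>
     z 0 = z0 \<and>
     (\<forall>t<T.
       if G (z t) \<le> \<tau>
       then \<exists>\<zeta> \<in> subdifferential Z F (z t) \<inter> SF (z t).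
              z (Suc t) = closest_point Z (z t - \<alpha> t *\<^sub>R \<zeta>)
       else \<exists>\<zeta> \<in> subdifferential Z G (z t) \<inter> SG (z t).
              z (Suc t) = closest_point Z (z t - \<alpha> t *\<^sub>R \<zeta>))"

text \<open>The set \<open>I\<close> of the method after \<open>T\<close> steps; \<open>J\<close> is its complement in \<open>{..<T}\<close>.\<close>

definition ssm_I :: "('a \<Rightarrow> real) \<Rightarrow> real \<Rightarrow> nat \<Rightarrow> (nat \<Rightarrow> 'a) \<Rightarrow> nat set" where
  "ssm_I G \<tau> T z = {t. t < T \<and> G (z t) \<le> \<tau>}"

definition ssm_output ::
    "('a::real_vector \<Rightarrow> real) \<Rightarrow> real \<Rightarrow> nat \<Rightarrow> (nat \<Rightarrow> 'a) \<Rightarrow> 'a" where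
  "ssm_output G \<tau> T z =
     (1 / (\<Sum>t\<in>ssm_I G \<tau> T z. real t + 1)) *\<^sub>R (\<Sum>t\<in>ssm_I G \<tau> T z. (real t + 1) *\<^sub>R z t)"

end

theory Submission
  imports Defs
begin

text \<open>
  Write \<open>D t = (norm (z t - zs))\<^sup>2\<close> and let \<open>\<Delta> t\<close> be the gap \<open>h (z t) - h zs\<close> of the function
  \<open>h \<in> {F, G}\<close> used in step \<open>t\<close>. Nonexpansiveness of the projection and strong convexity give
  \<open>D (t+1) \<le> (1 - \<mu> \<alpha> t) D t - 2 \<alpha> t \<Delta> t + (\<alpha> t)\<^sup>2 (L0\<^sup>2 + L1 \<Delta> t)\<close>.
  The stepsize is made so that this telescopes: with \<open>W t = (\<mu> t (t+1) + L1\<^sup>2/\<mu>)/2\<close> one has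
  \<open>\<alpha> t = (t+1) / W (t+1)\<close> and \<open>W (t+1) = W t + \<mu> (t+1)\<close>, so \<open>E t = W t D t\<close> satisfies
  \<open>E (t+1) \<le> E t - (t+1) c t \<Delta> t + (t+1) \<alpha> t L0\<^sup>2\<close> with \<open>c t = 2 - L1 \<alpha> t \<in> [1, 2]\<close>.

  If all gaps were nonnegative, \<open>c t \<ge> 1\<close> would allow the factor \<open>c t\<close> to be dropped. However, a point with
  \<open>0 < G (z t) \<le> \<tau>\<close> may have \<open>F (z t) < F zs\<close>, and then the factor \<open>c t\<close> works in the wrong direction.
  The remedy has two regimes, separated at \<open>t \<approx> L1/\<mu>\<close>, where \<open>\<alpha>\<close> is largest and \<open>c\<close> smallest.
  Before it, the norm bound forces \<open>\<Delta> t \<ge> - L0\<^sup>2/L1\<close>, so that a negative gap costs at most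
  \<open>(c t - 1) (t+1) (- \<Delta> t) \<le> L0\<^sup>2/\<mu>\<close>; the stepsize is still so small that
  \<open>(t+1) \<alpha> t L0\<^sup>2 \<le> L0\<^sup>2/\<mu>\<close>, and the two together stay within the bound \<open>2 L0\<^sup>2/\<mu>\<close>
  that \<open>(t+1) \<alpha> t L0\<^sup>2\<close> satisfies in general. After it, \<open>c\<close> is nondecreasing, so the
  inequality may be divided by \<open>c t\<close> and still telescopes. In total
  (lemma \<open>weighted_gap_sum\<close>)
  \<open>(\<Sum>t<T. (t+1) \<Delta> t) \<le> L1\<^sup>2 D 0 / (2\<mu>) + 2 T L0\<^sup>2/\<mu>\<close>.

  The lower bound on \<open>T\<close> makes the right-hand side at most \<open>\<tau> T\<^sup>2/2 \<le> \<tau> (\<Sum>t<T. t+1)\<close>. Every step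
  that uses \<open>G\<close> has gap at least \<open>\<tau>\<close>, since \<open>G zs \<le> 0\<close>. Hence the \<open>(t+1)\<close>-weighted mean of
  \<open>F (z t) - F zs\<close> over the remaining steps is at most \<open>\<tau>\<close>, and Jensen's inequality
  carries this bound, and \<open>G \<le> \<tau>\<close>, over to the output.
\<close>

section \<open>Strong convexity and one projected subgradient step\<close>

lemma strongly_convex_on_combination:
  assumes "strongly_convex_on \<mu> Z h" "x \<in> Z" "y \<in> Z" "0 \<le> u" "u \<le> 1"
  shows "h ((1 - u) *\<^sub>R x + u *\<^sub>R y)
           \<le> (1 - u) * h x + u * h y - \<mu> / 2 * (u * (1 - u) * (norm (x - y))\<^sup>2)"
proof -
  define p where "p = (1 - u) *\<^sub>R x + u *\<^sub>R y"
  have "h p - \<mu> / 2 * (norm p)\<^sup>2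
      \<le> (1 - u) * (h x - \<mu> / 2 * (norm x)\<^sup>2) + u * (h y - \<mu> / 2 * (norm y)\<^sup>2)"
    using assms unfolding strongly_convex_on_def p_def by (intro convex_onD) auto
  moreover have "(norm p)\<^sup>2
      = (1 - u) * (norm x)\<^sup>2 + u * (norm y)\<^sup>2 - u * (1 - u) * (norm (x - y))\<^sup>2"
    unfolding power2_norm_eq_inner p_def
    by (simp add: inner_add_left inner_add_right inner_diff_left inner_diff_right
        inner_commute algebra_simps)
  ultimately show ?thesis unfolding p_def[symmetric] by (simp add: field_simps)
qed

lemma strongly_convex_on_imp_convex_on:
  assumes "strongly_convex_on \<mu> Z h" "0 \<le> \<mu>"
  shows "convex_on Z h"
proof (rule convex_onI)
  show "convex Z"
    using assms(1) by (simp add: strongly_convex_on_def convex_on_def)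
  fix u :: real and x y
  assume u: "0 < u" "u < 1" and xy: "x \<in> Z" "y \<in> Z"
  have "0 \<le> \<mu> / 2 * (u * (1 - u) * (norm (x - y))\<^sup>2)"
    using u assms(2) by simp
  with strongly_convex_on_combination[OF assms(1) xy, of u] u
  show "h ((1 - u) *\<^sub>R x + u *\<^sub>R y) \<le> (1 - u) * h x + u * h y" by simp
qed

text \<open>
  The quadratic gain in the subgradient inequality: along the segment from \<open>x\<close> to \<open>y\<close>, strong
  convexity bounds \<open>h\<close> from above and the subgradient bounds it from below; comparing the two to first
  order at \<open>x\<close> gives the claim.
\<close>

lemma strongly_convex_on_subgradient:
  assumes h: "strongly_convex_on \<mu> Z h" and x: "x \<in> Z" and y: "y \<in> Z"
    and \<zeta>: "\<zeta> \<in> subdifferential Z h x"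
  shows "h x + \<zeta> \<bullet> (y - x) + \<mu> / 2 * (norm (x - y))\<^sup>2 \<le> h y"
proof -
  let ?N = "\<mu> / 2 * (norm (x - y))\<^sup>2"
  have below: "h x + \<zeta> \<bullet> (y - x) + (1 - u) * ?N \<le> h y" if u: "0 < u" "u < 1" for u
  proof -
    let ?p = "(1 - u) *\<^sub>R x + u *\<^sub>R y"
    have "convex Z" using h by (simp add: strongly_convex_on_def convex_on_def)
    then have "?p \<in> Z" using x y u by (simp add: convex_alt)
    then have "h x + \<zeta> \<bullet> (?p - x) \<le> h ?p" using \<zeta> by (simp add: subdifferential_def)
    moreover have "?p - x = u *\<^sub>R (y - x)" by (simp add: algebra_simps)
    ultimately have "h x + u * (\<zeta> \<bullet> (y - x)) \<le> h ?p" by simp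
    also have "\<dots> \<le> (1 - u) * h x + u * h y - \<mu> / 2 * (u * (1 - u) * (norm (x - y))\<^sup>2)"
      using strongly_convex_on_combination[OF h x y] u by simp
    finally have "u * (h x + \<zeta> \<bullet> (y - x) + (1 - u) * ?N) \<le> u * h y"
      by (simp add: field_simps)
    then show ?thesis using u by simp
  qed
  have "((\<lambda>u. h x + \<zeta> \<bullet> (y - x) + (1 - u) * ?N) \<longlongrightarrow> h x + \<zeta> \<bullet> (y - x) + (1 - 0) * ?N)
      (at_right 0)"
    by (intro tendsto_intros)
  moreover have "\<forall>\<^sub>F u in at_right (0::real). u \<in> {0<..<1}"
    by (rule eventually_at_right_real) simp
  then have "\<forall>\<^sub>F u in at_right (0::real). h x + \<zeta> \<bullet> (y - x) + (1 - u) * ?N \<le> h y"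
    by (rule eventually_mono) (use below in auto)
  ultimately have "h x + \<zeta> \<bullet> (y - x) + (1 - 0) * ?N \<le> h y"
    by (intro tendsto_upperbound) auto
  then show ?thesis by simp
qed

lemma projected_subgradient_step:
  fixes x y \<zeta> :: "'a::euclidean_space"
  assumes Z: "closed Z" and h: "strongly_convex_on \<mu> Z h"
    and x: "x \<in> Z" and y: "y \<in> Z" and \<zeta>: "\<zeta> \<in> subdifferential Z h x"
    and a: "0 \<le> a" and B: "(norm \<zeta>)\<^sup>2 \<le> B"
  shows "(norm (closest_point Z (x - a *\<^sub>R \<zeta>) - y))\<^sup>2
           \<le> (1 - \<mu> * a) * (norm (x - y))\<^sup>2 - 2 * a * (h x - h y) + a\<^sup>2 * B"
proof -
  have "convex Z" using h by (simp add: strongly_convex_on_def convex_on_def)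
  then have "dist (closest_point Z (x - a *\<^sub>R \<zeta>)) (closest_point Z y) \<le> dist (x - a *\<^sub>R \<zeta>) y"
    using Z y by (intro closest_point_lipschitz) auto
  then have "norm (closest_point Z (x - a *\<^sub>R \<zeta>) - y) \<le> norm ((x - y) - a *\<^sub>R \<zeta>)"
    using y by (simp add: closest_point_self dist_norm algebra_simps)
  then have "(norm (closest_point Z (x - a *\<^sub>R \<zeta>) - y))\<^sup>2 \<le> (norm ((x - y) - a *\<^sub>R \<zeta>))\<^sup>2"
    by (intro power_mono) auto
  also have "\<dots> = (norm (x - y))\<^sup>2 + 2 * a * (\<zeta> \<bullet> (y - x)) + a\<^sup>2 * (norm \<zeta>)\<^sup>2"
    unfolding power2_norm_eq_inner
    by (simp add: inner_diff_left inner_diff_right inner_commute power2_eq_square algebra_simps)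
  also have "\<dots> \<le> (norm (x - y))\<^sup>2 + 2 * a * (h y - h x - \<mu> / 2 * (norm (x - y))\<^sup>2) + a\<^sup>2 * B"
    using strongly_convex_on_subgradient[OF h x y \<zeta>] a B
    by (intro add_mono mult_left_mono order_refl) auto
  finally show ?thesis by (simp add: algebra_simps)
qed

section \<open>The stepsize and its telescoping weights\<close>

text \<open>
  The squared distance to the solution before step \<open>t\<close> is weighted by this number. It is
  \<open>t / \<alpha> (t-1)\<close> for \<open>t \<ge> 1\<close>, where \<open>\<alpha>\<close> is the stepsize; the closed form also gives the
  right initial value.
\<close>

definition energy_weight :: "real \<Rightarrow> real \<Rightarrow> nat \<Rightarrow> real" where
  "energy_weight \<mu> L t = (\<mu> * real t * (real t + 1) + L\<^sup>2 / \<mu>) / 2"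

definition stepsize :: "real \<Rightarrow> real \<Rightarrow> nat \<Rightarrow> real" where
  "stepsize \<mu> L t = (real t + 1) / energy_weight \<mu> L (Suc t)"

lemma energy_weight_Suc: "energy_weight \<mu> L (Suc t) = energy_weight \<mu> L t + \<mu> * (real t + 1)"
  by (simp add: energy_weight_def field_simps)

lemma energy_weight_nonneg: "0 \<le> \<mu> \<Longrightarrow> 0 \<le> energy_weight \<mu> L t"
  by (simp add: energy_weight_def)

lemma energy_weight_Suc_pos: "0 < \<mu> \<Longrightarrow> 0 < energy_weight \<mu> L (Suc t)"
  unfolding energy_weight_def by (intro divide_pos_pos add_pos_nonneg mult_pos_pos) auto

lemma stepsize_eq:
  assumes "0 < \<mu>"
  shows "stepsize \<mu> L t = 2 / (\<mu> * (real t + 2) + L\<^sup>2 / (\<mu> * (real t + 1)))"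
proof -
  let ?d = "\<mu> * (real t + 2) + L\<^sup>2 / (\<mu> * (real t + 1))"
  have weight: "energy_weight \<mu> L (Suc t) = (real t + 1) * ?d / 2"
    using assms by (simp add: energy_weight_def divide_simps) (simp add: algebra_simps)
  have "s / (s * d / 2) = 2 / d" if "s \<noteq> 0" for s d :: real
    using that by simp
  then show ?thesis unfolding stepsize_def weight by (metis add.commute of_nat_Suc of_nat_neq_0)
qed

lemma stepsize_pos: "0 < \<mu> \<Longrightarrow> 0 < stepsize \<mu> L t"
  using energy_weight_Suc_pos[of \<mu> L t] by (simp add: stepsize_def)

lemma stepsize_times_slope_le_1:
  assumes "0 < \<mu>"
  shows "L * stepsize \<mu> L t \<le> 1"
proof -
  let ?s = "real t + 1"
  have "0 \<le> (\<mu> * ?s - L)\<^sup>2 / \<mu> + \<mu> * ?s" using assms by simp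
  also have "\<dots> = 2 * (energy_weight \<mu> L (Suc t) - L * ?s)"
    using assms by (simp add: energy_weight_def power2_eq_square field_simps)
  finally show ?thesis
    using energy_weight_Suc_pos[OF assms, of L t] by (simp add: stepsize_def)
qed

lemma stepsize_scaled_le:
  assumes "0 < \<mu>"
  shows "(real t + 1) * stepsize \<mu> L t \<le> 2 / \<mu>"
proof -
  let ?s = "real t + 1"
  have "2 * energy_weight \<mu> L (Suc t) = \<mu> * ?s * ?s + \<mu> * ?s + L\<^sup>2 / \<mu>"
    by (simp add: energy_weight_def algebra_simps)
  then have "\<mu> * ?s * ?s \<le> 2 * energy_weight \<mu> L (Suc t)"
    using assms by simp
  then show ?thesis
    using energy_weight_Suc_pos[OF assms, of L t] assms
    by (simp add: stepsize_def divide_simps mult_ac)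
qed

lemma stepsize_scaled_le_early:
  assumes "0 < \<mu>" and early: "\<mu> * (real t + 1) \<le> L"
  shows "(real t + 1) * stepsize \<mu> L t \<le> 1 / \<mu>"
proof -
  let ?s = "real t + 1"
  have "(\<mu> * ?s)\<^sup>2 \<le> L\<^sup>2" using assms by (intro power_mono) auto
  then have "(\<mu> * ?s)\<^sup>2 / \<mu> \<le> L\<^sup>2 / \<mu>" using assms by (intro divide_right_mono) auto
  then have "\<mu> * ?s * ?s \<le> L\<^sup>2 / \<mu>" using assms by (simp add: power2_eq_square mult_ac)
  moreover have "2 * energy_weight \<mu> L (Suc t) = \<mu> * ?s * ?s + \<mu> * ?s + L\<^sup>2 / \<mu>"
    by (simp add: energy_weight_def algebra_simps)
  moreover have "0 \<le> \<mu> * ?s" using assms by simp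
  ultimately have "\<mu> * ?s * ?s \<le> energy_weight \<mu> L (Suc t)" by linarith
  then show ?thesis
    using energy_weight_Suc_pos[OF assms(1), of L t] assms(1)
    by (simp add: stepsize_def divide_simps mult_ac)
qed

lemma stepsize_decreasing_late:
  assumes "0 < \<mu>" "0 \<le> L" and late: "L \<le> \<mu> * (real t + 1)"
  shows "stepsize \<mu> L (Suc t) \<le> stepsize \<mu> L t"
proof -
  let ?s = "real t + 1"
  let ?w = "energy_weight \<mu> L (Suc t)"
  have "L\<^sup>2 \<le> (\<mu> * ?s)\<^sup>2" using assms by (intro power_mono) auto
  then have "L\<^sup>2 / \<mu> \<le> (\<mu> * ?s)\<^sup>2 / \<mu>" using assms by (intro divide_right_mono) auto
  then have "L\<^sup>2 / \<mu> \<le> \<mu> * ?s * ?s" using assms by (simp add: power2_eq_square mult_ac)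
  moreover have "2 * ?w = \<mu> * ?s * ?s + \<mu> * ?s + L\<^sup>2 / \<mu>"
    by (simp add: energy_weight_def algebra_simps)
  moreover have "0 \<le> \<mu> * ?s" using assms by simp
  ultimately have "?w \<le> \<mu> * ?s * (?s + 1)" by (simp add: algebra_simps)
  then have "(?s + 1) * ?w \<le> ?s * energy_weight \<mu> L (Suc (Suc t))"
    unfolding energy_weight_Suc[of _ _ "Suc t"] by (simp add: algebra_simps)
  then show ?thesis
    using energy_weight_Suc_pos[OF assms(1), of L t] energy_weight_Suc_pos[OF assms(1), of L "Suc t"]
    by (simp add: stepsize_def divide_simps mult_ac)
qed

lemma energy_step:
  assumes \<mu>: "0 < \<mu>"
    and step: "D' \<le> (1 - \<mu> * stepsize \<mu> L t) * D - 2 * stepsize \<mu> L t * \<Delta>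
                   + (stepsize \<mu> L t)\<^sup>2 * (M\<^sup>2 + L * \<Delta>)"
  shows "energy_weight \<mu> L (Suc t) * D'
           \<le> energy_weight \<mu> L t * D - (2 - L * stepsize \<mu> L t) * ((real t + 1) * \<Delta>)
             + (real t + 1) * stepsize \<mu> L t * M\<^sup>2"
proof -
  let ?w = "energy_weight \<mu> L (Suc t)"
  let ?a = "stepsize \<mu> L t"
  have wa: "?w * ?a = real t + 1"
    using energy_weight_Suc_pos[OF \<mu>, of L t] by (simp add: stepsize_def)
  have "?w * D' \<le> ?w * ((1 - \<mu> * ?a) * D - 2 * ?a * \<Delta> + ?a\<^sup>2 * (M\<^sup>2 + L * \<Delta>))"
    using step energy_weight_Suc_pos[OF \<mu>, of L t] by (intro mult_left_mono) auto
  also have "\<dots> = (?w - \<mu> * (?w * ?a)) * D - 2 * (?w * ?a) * \<Delta>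
                 + (?w * ?a) * ?a * (M\<^sup>2 + L * \<Delta>)"
    by (simp add: algebra_simps power2_eq_square)
  also have "\<dots> = energy_weight \<mu> L t * D - (2 - L * ?a) * ((real t + 1) * \<Delta>)
                 + (real t + 1) * ?a * M\<^sup>2"
    unfolding wa by (simp add: energy_weight_Suc algebra_simps)
  finally show ?thesis .
qed

section \<open>Summing the gaps\<close>

text \<open>
  The factor by which the energy before step \<open>n\<close> is discounted. It turns
  the coefficient \<open>2 - L * stepsize \<mu> L t\<close> of the gap into \<open>1\<close>, exactly in the late regime
  and up to an affordable error in the early one. The factor used after step \<open>t\<close> is
  \<open>discount \<mu> L (Suc t)\<close>, whence the shifted index; \<open>n = 0\<close> falls under the first case
  when \<open>L \<ge> 0\<close>.
\<close>

definition discount :: "real \<Rightarrow> real \<Rightarrow> nat \<Rightarrow> real" where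
  "discount \<mu> L n = (if \<mu> * real n \<le> L then 1 else 1 / (2 - L * stepsize \<mu> L (n - 1)))"

lemma discount_nonneg: "0 < \<mu> \<Longrightarrow> 0 \<le> discount \<mu> L n"
  using stepsize_times_slope_le_1[of \<mu> L "n - 1"] by (simp add: discount_def)

lemma discount_late:
  assumes "L < \<mu> * (real t + 1)"
  shows "discount \<mu> L (Suc t) = 1 / (2 - L * stepsize \<mu> L t)"
  using assms by (simp add: discount_def add.commute)

lemma discount_Suc_le:
  assumes \<mu>: "0 < \<mu>" and L: "0 \<le> L" and late: "L < \<mu> * (real t + 1)"
  shows "discount \<mu> L (Suc t) \<le> discount \<mu> L t"
proof (cases "\<mu> * real t \<le> L")
  case True
  then show ?thesis
    using stepsize_times_slope_le_1[OF \<mu>, of L t] late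
    by (simp add: discount_late) (simp add: discount_def)
next
  case False
  then obtain s where s: "t = Suc s" using L by (cases t) auto
  have "L * stepsize \<mu> L t \<le> L * stepsize \<mu> L s"
    using False L stepsize_decreasing_late[OF \<mu> L, of s]
    by (intro mult_left_mono) (auto simp: s add.commute)
  then have "1 / (2 - L * stepsize \<mu> L t) \<le> 1 / (2 - L * stepsize \<mu> L s)"
    using stepsize_times_slope_le_1[OF \<mu>, of L s] by (intro divide_left_mono mult_pos_pos) auto
  then show ?thesis using False late by (simp add: discount_late) (simp add: discount_def s)
qed

text \<open>
  One step of the telescoping for a gap of either sign. In the early regime a negative gap
  is small because \<open>M\<^sup>2 + L * \<Delta>\<close> bounds a squared norm, and \<open>(t + 1) / L \<le> 1 / \<mu>\<close> there.
\<close>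

lemma discounted_energy_step:
  assumes \<mu>: "0 < \<mu>" and L: "0 \<le> L" and D: "0 \<le> D" and nonneg: "0 \<le> M\<^sup>2 + L * \<Delta>"
    and step: "D' \<le> (1 - \<mu> * stepsize \<mu> L t) * D - 2 * stepsize \<mu> L t * \<Delta>
                   + (stepsize \<mu> L t)\<^sup>2 * (M\<^sup>2 + L * \<Delta>)"
  shows "discount \<mu> L (Suc t) * (energy_weight \<mu> L (Suc t) * D')
           \<le> discount \<mu> L t * (energy_weight \<mu> L t * D) - (real t + 1) * \<Delta> + 2 * M\<^sup>2 / \<mu>"
proof -
  let ?s = "real t + 1"
  let ?a = "stepsize \<mu> L t"
  let ?c = "2 - L * ?a"
  let ?E = "energy_weight \<mu> L t * D"
  let ?E' = "energy_weight \<mu> L (Suc t) * D'"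
  have c: "1 \<le> ?c" "?c \<le> 2"
    using stepsize_times_slope_le_1[OF \<mu>, of L t] stepsize_pos[OF \<mu>, of L t] L by auto
  have E: "?E' \<le> ?E - ?c * (?s * \<Delta>) + ?s * ?a * M\<^sup>2"
    using energy_step[OF \<mu> step] .
  show ?thesis
  proof (cases "\<mu> * ?s \<le> L")
    case early: True
    then have "\<mu> * real t \<le> L" using \<mu> by (simp add: algebra_simps)
    with early have q: "discount \<mu> L (Suc t) = 1" "discount \<mu> L t = 1"
      by (auto simp: discount_def add.commute)
    have noise: "?s * ?a * M\<^sup>2 \<le> M\<^sup>2 / \<mu>"
      using mult_right_mono[OF stepsize_scaled_le_early[OF \<mu> early], of "M\<^sup>2"] by simp
    have "- (?s * \<Delta>) \<le> M\<^sup>2 / \<mu>"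
    proof -
      have "\<mu> * ?s * (- \<Delta>) \<le> M\<^sup>2"
      proof (cases "0 \<le> \<Delta>")
        case True
        then have "\<mu> * ?s * (- \<Delta>) \<le> 0" using \<mu> by (simp add: mult_nonneg_nonneg)
        also have "\<dots> \<le> M\<^sup>2" by simp
        finally show ?thesis .
      next
        case False
        then have "\<mu> * ?s * (- \<Delta>) \<le> L * (- \<Delta>)"
          by (intro mult_right_mono early) auto
        also have "\<dots> \<le> M\<^sup>2" using nonneg by simp
        finally show ?thesis .
      qed
      then show ?thesis using \<mu> by (simp add: field_simps)
    qed
    then have "(?c - 1) * (- (?s * \<Delta>)) \<le> (?c - 1) * (M\<^sup>2 / \<mu>)"
      using c by (intro mult_left_mono) auto
    also have "\<dots> \<le> 1 * (M\<^sup>2 / \<mu>)"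
      using c \<mu> by (intro mult_right_mono) auto
    finally have "?s * \<Delta> - M\<^sup>2 / \<mu> \<le> ?c * (?s * \<Delta>)"
      by (simp add: algebra_simps)
    with E noise have "?E' \<le> ?E - ?s * \<Delta> + 2 * (M\<^sup>2 / \<mu>)" by linarith
    then show ?thesis by (simp add: q)
  next
    case False
    then have late: "L < \<mu> * ?s" by simp
    have noise: "?s * ?a * M\<^sup>2 \<le> 2 * M\<^sup>2 / \<mu>"
      using mult_right_mono[OF stepsize_scaled_le[OF \<mu>, of t L], of "M\<^sup>2"] by simp
    have q: "discount \<mu> L (Suc t) = 1 / ?c" by (rule discount_late[OF late])
    have "1 / ?c * ?E' \<le> 1 / ?c * (?E - ?c * (?s * \<Delta>) + ?s * ?a * M\<^sup>2)"
      using E c by (intro mult_left_mono) auto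
    also have "\<dots> = 1 / ?c * ?E - ?s * \<Delta> + 1 / ?c * (?s * ?a * M\<^sup>2)"
      using c by (simp add: diff_divide_distrib add_divide_distrib)
    also have "1 / ?c * (?s * ?a * M\<^sup>2) \<le> 1 * (?s * ?a * M\<^sup>2)"
      using c stepsize_pos[OF \<mu>, of L t] by (intro mult_right_mono) auto
    also have "1 / ?c * ?E \<le> discount \<mu> L t * ?E"
      using discount_Suc_le[OF \<mu> L late] D energy_weight_nonneg[of \<mu> L t] \<mu>
      unfolding q by (intro mult_right_mono) auto
    finally show ?thesis using noise unfolding q by simp
  qed
qed

lemma weighted_gap_sum:
  fixes D \<Delta> :: "nat \<Rightarrow> real"
  assumes \<mu>: "0 < \<mu>" and L: "0 \<le> L" and D: "\<And>t. 0 \<le> D t"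
    and nonneg: "\<And>t. t < n \<Longrightarrow> 0 \<le> M\<^sup>2 + L * \<Delta> t"
    and step: "\<And>t. t < n \<Longrightarrow>
      D (Suc t) \<le> (1 - \<mu> * stepsize \<mu> L t) * D t - 2 * stepsize \<mu> L t * \<Delta> t
                   + (stepsize \<mu> L t)\<^sup>2 * (M\<^sup>2 + L * \<Delta> t)"
  shows "(\<Sum>t<n. (real t + 1) * \<Delta> t) \<le> L\<^sup>2 / (2 * \<mu>) * D 0 + 2 * real n * M\<^sup>2 / \<mu>"
proof -
  let ?\<Phi> = "\<lambda>t. discount \<mu> L t * (energy_weight \<mu> L t * D t)"
  have "(\<Sum>t<m. (real t + 1) * \<Delta> t) + ?\<Phi> m \<le> L\<^sup>2 / (2 * \<mu>) * D 0 + 2 * real m * M\<^sup>2 / \<mu>"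
    if "m \<le> n" for m
    using that
  proof (induction m)
    case 0
    then show ?case using L by (simp add: discount_def energy_weight_def)
  next
    case (Suc m)
    have "?\<Phi> (Suc m) \<le> ?\<Phi> m - (real m + 1) * \<Delta> m + 2 * M\<^sup>2 / \<mu>"
      using Suc.prems by (intro discounted_energy_step[OF \<mu> L D nonneg step]) auto
    moreover have "2 * real (Suc m) * M\<^sup>2 / \<mu> = 2 * real m * M\<^sup>2 / \<mu> + 2 * M\<^sup>2 / \<mu>"
      by (simp add: add_divide_distrib algebra_simps)
    ultimately show ?case using Suc.IH Suc.prems by simp
  qed
  moreover have "0 \<le> ?\<Phi> n"
    using discount_nonneg[OF \<mu>] energy_weight_nonneg \<mu> D by simp
  ultimately show ?thesis by (meson add_increasing2 order_refl order_trans)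
qed

section \<open>Guarantee for the output\<close>

lemma horizon_absorbs_error:
  fixes T :: nat
  assumes \<mu>: "0 < \<mu>" and \<tau>: "0 < \<tau>"
    and T1: "8 * M\<^sup>2 / (\<mu> * \<tau>) \<le> real T"
    and T2: "sqrt (2 * L\<^sup>2 * d\<^sup>2 / (\<mu> * \<tau>)) \<le> real T"
  shows "L\<^sup>2 / (2 * \<mu>) * d\<^sup>2 + 2 * real T * M\<^sup>2 / \<mu> \<le> \<tau> * (\<Sum>t<T. real t + 1)"
proof -
  have "2 * L\<^sup>2 * d\<^sup>2 / (\<mu> * \<tau>) \<le> (real T)\<^sup>2"
    using T2 by (rule sqrt_le_D)
  then have initial: "L\<^sup>2 / (2 * \<mu>) * d\<^sup>2 \<le> \<tau> * (real T)\<^sup>2 / 4"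
    using \<mu> \<tau> by (simp add: field_simps)
  have "8 * M\<^sup>2 \<le> real T * (\<mu> * \<tau>)"
    using T1 \<mu> \<tau> by (simp add: field_simps)
  then have "real T * (8 * M\<^sup>2) \<le> real T * (real T * (\<mu> * \<tau>))"
    by (intro mult_left_mono) auto
  then have noise: "2 * real T * M\<^sup>2 / \<mu> \<le> \<tau> * (real T)\<^sup>2 / 4"
    using \<mu> by (simp add: field_simps power2_eq_square)
  have sum: "(\<Sum>t<n. real t + 1) = real n * (real n + 1) / 2" for n :: nat
    by (induction n) (auto simp: field_simps)
  have "\<tau> * (real T)\<^sup>2 / 2 \<le> \<tau> * (\<Sum>t<T. real t + 1)"
    using \<tau> unfolding sum by (simp add: power2_eq_square field_simps)
  with initial noise show ?thesis by linarith
qed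

lemma convex_on_weighted_mean_le:
  fixes w :: "'i \<Rightarrow> real"
  assumes h: "convex_on Z h" and I: "finite I" and Z: "\<And>i. i \<in> I \<Longrightarrow> x i \<in> Z"
    and w: "\<And>i. i \<in> I \<Longrightarrow> 0 \<le> w i" and pos: "0 < sum w I"
    and bound: "(\<Sum>i\<in>I. w i * h (x i)) \<le> b * sum w I"
  shows "(1 / sum w I) *\<^sub>R (\<Sum>i\<in>I. w i *\<^sub>R x i) \<in> Z"
    and "h ((1 / sum w I) *\<^sub>R (\<Sum>i\<in>I. w i *\<^sub>R x i)) \<le> b"
proof -
  let ?v = "\<lambda>i. w i / sum w I"
  have mean: "(1 / sum w I) *\<^sub>R (\<Sum>i\<in>I. w i *\<^sub>R x i) = (\<Sum>i\<in>I. ?v i *\<^sub>R x i)"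
    by (simp add: scaleR_sum_right)
  have v1: "sum ?v I = 1" using pos by (simp flip: sum_divide_distrib)
  have v0: "0 \<le> ?v i" if "i \<in> I" for i using that w pos by simp
  have "convex Z" using h by (simp add: convex_on_def)
  then show "(1 / sum w I) *\<^sub>R (\<Sum>i\<in>I. w i *\<^sub>R x i) \<in> Z"
    unfolding mean using I v1 v0 Z by (intro convex_sum)
  have "I \<noteq> {}" using pos by auto
  then have "h (\<Sum>i\<in>I. ?v i *\<^sub>R x i) \<le> (\<Sum>i\<in>I. ?v i * h (x i))"
    using I h v1 v0 Z by (intro convex_on_sum)
  also have "\<dots> = (\<Sum>i\<in>I. w i * h (x i)) / sum w I"
    by (simp add: sum_divide_distrib)
  also have "\<dots> \<le> b" using bound pos by (simp add: field_simps)
  finally show "h ((1 / sum w I) *\<^sub>R (\<Sum>i\<in>I. w i *\<^sub>R x i)) \<le> b" unfolding mean .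
qed

theorem theorem3p1:
  fixes Z :: "(real ^ 'd) set"
    and F G :: "real ^ 'd \<Rightarrow> real"
    and SF SG :: "real ^ 'd \<Rightarrow> (real ^ 'd) set"
    and zs z0 :: "real ^ 'd"
    and z :: "nat \<Rightarrow> real ^ 'd"
    and \<mu> \<tau> L0 L1 :: real
    and \<alpha> :: "nat \<Rightarrow> real"
    and T :: nat
  assumes "closed Z" and "convex Z"
    and "\<mu> > 0"
    and "strongly_convex_on \<mu> Z F" and "strongly_convex_on \<mu> Z G"
    and "optimal_solution Z F G zs"
    and "\<And>w. optimal_solution Z F G w \<Longrightarrow> w = zs"
    and "\<tau> > 0" and "L0 \<ge> 0" and "L1 \<ge> 0"
    and "\<And>z1 \<zeta>. \<lbrakk>z1 \<in> Z; G z1 \<le> \<tau>; \<zeta> \<in> subdifferential Z F z1; \<zeta> \<in> SF z1\<rbrakk>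
           \<Longrightarrow> (norm \<zeta>)\<^sup>2 \<le> L0\<^sup>2 + L1 * (F z1 - F zs)"
    and "\<And>z2 \<zeta>. \<lbrakk>z2 \<in> Z; G z2 > \<tau>; \<zeta> \<in> subdifferential Z G z2; \<zeta> \<in> SG z2\<rbrakk>
           \<Longrightarrow> (norm \<zeta>)\<^sup>2 \<le> L0\<^sup>2 + L1 * (G z2 - G zs)"
    and "\<And>t. \<alpha> t = 2 / (\<mu> * (real t + 2) + L1\<^sup>2 / (\<mu> * (real t + 1)))"
    and "z0 \<in> Z" and "G z0 \<le> \<tau>"
    and "T \<ge> 1"
    and "real T \<ge> max (8 * L0\<^sup>2 / (\<mu> * \<tau>)) (sqrt (2 * L1\<^sup>2 * (norm (z0 - zs))\<^sup>2 / (\<mu> * \<tau>)))"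
    and "ssm_run Z F G SF SG \<tau> T z0 \<alpha> z"
  shows "approx_optimal_solution Z F G zs \<tau> \<tau> (ssm_output G \<tau> T z)"
proof -
  note Z = \<open>closed Z\<close> and \<mu> = \<open>\<mu> > 0\<close> and \<tau> = \<open>\<tau> > 0\<close> and L1 = \<open>L1 \<ge> 0\<close>
  note FS = \<open>strongly_convex_on \<mu> Z F\<close> and GS = \<open>strongly_convex_on \<mu> Z G\<close>
  note normF = assms(11) and normG = assms(12)
  note run = \<open>ssm_run Z F G SF SG \<tau> T z0 \<alpha> z\<close>
  have \<alpha>: "\<alpha> t = stepsize \<mu> L1 t" for t
    using assms(13) stepsize_eq[OF \<mu>] by simp
  have zs: "zs \<in> Z" "G zs \<le> 0"
    using \<open>optimal_solution Z F G zs\<close> by (auto simp: optimal_solution_def)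
  have z0: "z 0 = z0" using run by (simp add: ssm_run_def)
  have inZ: "z t \<in> Z" if "t \<le> T" for t
  proof (cases t)
    case 0
    then show ?thesis using z0 \<open>z0 \<in> Z\<close> by simp
  next
    case (Suc s)
    then have "\<exists>y. z t = closest_point Z y"
      using run that unfolding ssm_run_def by (metis Suc_le_lessD)
    moreover have "closest_point Z y \<in> Z" for y
      using closest_point_in_set[OF Z] zs by blast
    ultimately show ?thesis by metis
  qed

  define h where "h t = (if G (z t) \<le> \<tau> then F else G)" for t
  define \<Delta> where "\<Delta> t = h t (z t) - h t zs" for t
  define D where "D t = (norm (z t - zs))\<^sup>2" for t

  have subgrad: "\<exists>\<zeta> \<in> subdifferential Z (h t) (z t).
        z (Suc t) = closest_point Z (z t - stepsize \<mu> L1 t *\<^sub>R \<zeta>)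
        \<and> (norm \<zeta>)\<^sup>2 \<le> L0\<^sup>2 + L1 * \<Delta> t" if t: "t < T" for t
  proof (cases "G (z t) \<le> \<tau>")
    case True
    then show ?thesis
      using run t normF[OF inZ[of t]] unfolding ssm_run_def \<alpha> by (fastforce simp: h_def \<Delta>_def)
  next
    case False
    then show ?thesis
      using run t normG[OF inZ[of t]] unfolding ssm_run_def \<alpha> by (fastforce simp: h_def \<Delta>_def)
  qed
  have hS: "strongly_convex_on \<mu> Z (h t)" for t
    using FS GS by (simp add: h_def)

  have "(\<Sum>t<T. (real t + 1) * \<Delta> t) \<le> L1\<^sup>2 / (2 * \<mu>) * D 0 + 2 * real T * L0\<^sup>2 / \<mu>"
  proof (rule weighted_gap_sum[OF \<mu> L1])
    show "0 \<le> D t" for t by (simp add: D_def)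
    fix t assume t: "t < T"
    obtain \<zeta> where \<zeta>: "\<zeta> \<in> subdifferential Z (h t) (z t)"
      and z: "z (Suc t) = closest_point Z (z t - stepsize \<mu> L1 t *\<^sub>R \<zeta>)"
      and N: "(norm \<zeta>)\<^sup>2 \<le> L0\<^sup>2 + L1 * \<Delta> t"
      using subgrad[OF t] by blast
    show "0 \<le> L0\<^sup>2 + L1 * \<Delta> t" using N zero_le_power2 order_trans by blast
    show "D (Suc t) \<le> (1 - \<mu> * stepsize \<mu> L1 t) * D t - 2 * stepsize \<mu> L1 t * \<Delta> t
            + (stepsize \<mu> L1 t)\<^sup>2 * (L0\<^sup>2 + L1 * \<Delta> t)"
      using projected_subgradient_step[OF Z hS _ zs(1) \<zeta> _ N] inZ[of t] t
        stepsize_pos[OF \<mu>, of L1 t]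
      unfolding D_def z by (simp add: \<Delta>_def)
  qed
  also have "\<dots> \<le> \<tau> * (\<Sum>t<T. real t + 1)"
    using horizon_absorbs_error[OF \<mu> \<tau>, of L0 T L1 "norm (z0 - zs)"] assms(17)
    by (simp add: D_def z0)
  finally have total: "(\<Sum>t<T. (real t + 1) * (\<Delta> t - \<tau>)) \<le> 0"
    by (simp add: right_diff_distrib sum_subtractf sum_distrib_left mult.commute[of \<tau>])

  define I where "I = ssm_I G \<tau> T z"
  have I: "I \<subseteq> {..<T}" "finite I" and Igood: "\<And>t. t \<in> I \<Longrightarrow> G (z t) \<le> \<tau>"
    by (auto simp: I_def ssm_I_def)
  have "0 \<in> I" using z0 \<open>G z0 \<le> \<tau>\<close> \<open>T \<ge> 1\<close> by (auto simp: I_def ssm_I_def)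
  then have pos: "0 < (\<Sum>t\<in>I. real t + 1)"
    using I(2) by (intro sum_pos) auto

  \<comment> \<open>The steps outside \<open>I\<close> have gap above \<open>\<tau>\<close>, so removing them keeps the sum nonpositive.\<close>
  have "(\<Sum>t\<in>I. (real t + 1) * (\<Delta> t - \<tau>)) \<le> (\<Sum>t<T. (real t + 1) * (\<Delta> t - \<tau>))"
  proof (rule sum_mono2[OF _ I(1)])
    fix t assume "t \<in> {..<T} - I"
    then have "\<tau> < G (z t)" by (auto simp: I_def ssm_I_def)
    then have "\<tau> \<le> \<Delta> t" using zs(2) by (simp add: \<Delta>_def h_def)
    then show "0 \<le> (real t + 1) * (\<Delta> t - \<tau>)" by simp
  qed simp
  also note total
  also have "(\<Sum>t\<in>I. (real t + 1) * (\<Delta> t - \<tau>))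
      = (\<Sum>t\<in>I. (real t + 1) * F (z t) - (F zs + \<tau>) * (real t + 1))"
    using Igood by (intro sum.cong) (auto simp: \<Delta>_def h_def algebra_simps)
  finally have boundF: "(\<Sum>t\<in>I. (real t + 1) * F (z t)) \<le> (F zs + \<tau>) * (\<Sum>t\<in>I. real t + 1)"
    by (simp add: sum_subtractf sum_distrib_left)
  have boundG: "(\<Sum>t\<in>I. (real t + 1) * G (z t)) \<le> \<tau> * (\<Sum>t\<in>I. real t + 1)"
    unfolding sum_distrib_left using Igood
    by (intro sum_mono) (metis mult.commute mult_left_mono of_nat_0_le_iff add_nonneg_nonneg zero_le_one)

  have IZ: "z t \<in> Z" if "t \<in> I" for t
    using that I(1) inZ[of t] by auto
  have w: "0 \<le> real t + 1" for t :: nat by simp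
  note meanF = convex_on_weighted_mean_le
      [OF strongly_convex_on_imp_convex_on[OF FS] I(2) IZ w pos boundF]
  note meanG = convex_on_weighted_mean_le
      [OF strongly_convex_on_imp_convex_on[OF GS] I(2) IZ w pos boundG]
  show ?thesis
    using meanF meanG \<mu> unfolding approx_optimal_solution_def ssm_output_def I_def by simp
qed

end
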